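(* Let $N\ge 1$ and $K\ge 2$ be integers, and let $\mathbf{M}=[\mathbf{v_1}\ \cdots\ \mathbf{v_N}]\in\mathbb{R}^{N\times N}$ be a nonsingular generator matrix with $|\det\mathbf{M}|=1$, generating the lattice $\Lambda=\{\mathbf{M}\mathbf{z}:\mathbf{z}\in\mathbb{Z}^N\}$. Consider the finite lattice constellation $\Lambda'=\{\mathbf{M}\mathbf{u}: u_i\in\{0,1,\dots,K-1\}\}$ with $K^N$ equiprobable points transmitted over the AWGN channel $\mathbf{y}=\mathbf{x}+\mathbf{w}$ ($\mathbf{w}$ with i.i.d. $\mathcal{N}(0,\sigma^2)$ components) with maximum-likelihood detection, and let $\rho=1/\sigma^2$ and $P(\rho)$ be its symbol error probability. Let $d_{min}$ be the minimum distance between distinct points of $\Lambda$, $\mathcal{R}=d_{min}/2$, and define $\mathcal{I}_0=1$ and $\mathcal{I}_k=1-\dfrac{\Gamma\!\left(\frac{k}{2},\frac{\mathcal{R}^2}{2}\rho\right)}{\Gamma\!\left(\frac{k}{2}\right)}$ for $1\le k\le N$. Then $$P(\rho)\ \le\ P_{msub}(\rho):=1-\frac{1}{K^N}\sum_{k=0}^N (K-1)^k\binom{N}{k}\mathcal{I}_k.$$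
   Context: The symbol error probability is $P(\rho)=1-\frac{1}{K^N}\sum_{i=1}^{K^N}\Pr(\text{correct ML decision}\mid i\text{-th point sent})$. $\Gamma(\cdot)$ is the Gamma function and $\Gamma(a,x)=\int_x^\infty t^{a-1}e^{-t}\,dt$ is the upper incomplete Gamma function. $\mathcal{I}_k$ equals the probability that a $k$-dimensional zero-mean Gaussian vector with covariance $\sigma^2\mathbf{I}_k$ lies in the ball of radius $\mathcal{R}$. *)

theory Defs
  imports "HOL-Probability.Probability"
begin

definition lattice_of :: "real^'n^'n \<Rightarrow> (real^'n) set" where
  "lattice_of M = {M *v z | z. \<forall>i. z $ i \<in> \<int>}"

definition constellation :: "real^'n^'n \<Rightarrow> nat \<Rightarrow> (real^'n) set" where
  "constellation M K = {M *v u | u. \<forall>i. u $ i \<in> real ` {..<K}}"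

definition d_min :: "real^'n^'n \<Rightarrow> real" where
  "d_min M = Inf {dist x y | x y. x \<in> lattice_of M \<and> y \<in> lattice_of M \<and> x \<noteq> y}"

definition upper_inc_Gamma :: "real \<Rightarrow> real \<Rightarrow> real" where
  "upper_inc_Gamma a x = (LBINT t:{x..}. t powr (a - 1) * exp (- t))"

definition I_k :: "nat \<Rightarrow> real \<Rightarrow> real \<Rightarrow> real" where
  "I_k k R \<rho> = (if k = 0 then 1
     else 1 - upper_inc_Gamma (real k / 2) (R^2 / 2 * \<rho>) / Gamma (real k / 2))"

definition noise_density :: "real \<Rightarrow> real^'n \<Rightarrow> real" where
  "noise_density \<sigma> w = (\<Prod>i\<in>UNIV. normal_density 0 \<sigma> (w $ i))"

definition noise :: "real \<Rightarrow> (real^'n) measure" where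
  "noise \<sigma> = density lborel (\<lambda>w. ennreal (noise_density \<sigma> w))"

definition likelihood :: "real \<Rightarrow> real^'n \<Rightarrow> real^'n \<Rightarrow> real" where
  "likelihood \<sigma> y x = noise_density \<sigma> (y - x)"

text \<open>Probability that the ML decision is correct when x is sent
  (correct = x is the unique maximiser of the likelihood; ties have probability 0).\<close>
definition correct_prob :: "real^'n^'n \<Rightarrow> nat \<Rightarrow> real \<Rightarrow> real^'n \<Rightarrow> real" where
  "correct_prob M K \<sigma> x = measure (noise \<sigma>)
     {w. \<forall>p\<in>constellation M K. p \<noteq> x \<longrightarrow> likelihood \<sigma> (x + w) p < likelihood \<sigma> (x + w) x}"

text \<open>Symbol error probability P(rho), with sigma = 1/sqrt rho.\<close>
definition SEP :: "real^'n^'n \<Rightarrow> nat \<Rightarrow> real \<Rightarrow> real" where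
  "SEP M K \<sigma> = 1 - (1 / real K ^ CARD('n)) * (\<Sum>x\<in>constellation M K. correct_prob M K \<sigma> x)"

end

theory Submission
  imports Defs
begin

text \<open>
  For a set \<open>S\<close> of coordinates, split the noise as \<open>w = p + q\<close>, where \<open>q\<close> is the projection
  of \<open>w\<close> onto the span of the columns of \<open>M\<close> indexed by \<open>S\<close>. If \<open>\<bar>q\<bar> < \<R>\<close>, then \<open>w\<close> is decoded
  correctly for \<open>(K - 1) ^ \<bar>S\<bar>\<close> transmitted points: off \<open>S\<close> the coordinate is the extreme one
  selected by the sign of \<open>p \<bullet> v\<^sub>i\<close>, so that no available lattice direction has positive inner product
  with \<open>p\<close>, and on \<open>S\<close> only one extreme value is excluded. Almost surely different sets \<open>S\<close>
  give different points, because \<open>p\<close> is the projection of \<open>w\<close> onto a cone depending only on the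
  transmitted point. Hence the number of transmitted points decoded correctly under
  noise \<open>w\<close> is at least the sum of \<open>(K - 1) ^ \<bar>S\<bar>\<close> over the \<open>S\<close> with \<open>\<bar>q\<bar> < \<R>\<close>. Taking expectations
  gives the bound, since \<open>\<bar>q\<bar>\<^sup>2\<close> is \<open>\<sigma>\<^sup>2\<close> times a chi-square variable with \<open>\<bar>S\<bar>\<close> degrees of freedom.
\<close>

section \<open>Invariance of Lebesgue measure under linear isometries\<close>

lemma nn_integral_lborel_shift:
  fixes g :: "'a::euclidean_space \<Rightarrow> ennreal"
  assumes [measurable]: "g \<in> borel_measurable borel"
  shows "(\<integral>\<^sup>+x. g (c + x) \<partial>lborel) = (\<integral>\<^sup>+x. g x \<partial>lborel)"
proof -
  have "(\<integral>\<^sup>+x. g x \<partial>lborel) = (\<integral>\<^sup>+x. g x \<partial>distr lborel borel ((+) c))"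
    by (simp add: lborel_distr_plus)
  also have "\<dots> = (\<integral>\<^sup>+x. g (c + x) \<partial>lborel)"
    by (rule nn_integral_distr) auto
  finally show ?thesis by simp
qed

lemma nn_integral_lborel_reflect:
  fixes g :: "'a::euclidean_space \<Rightarrow> ennreal"
  assumes [measurable]: "g \<in> borel_measurable borel"
  shows "(\<integral>\<^sup>+x. g (c - x) \<partial>lborel) = (\<integral>\<^sup>+x. g x \<partial>lborel)"
proof -
  have "(lborel :: 'a measure) = distr lborel borel (\<lambda>x. c - x)"
    using lborel_affine[of "-1" c] by (simp add: density_1)
  then have "(\<integral>\<^sup>+x. g x \<partial>lborel) = (\<integral>\<^sup>+x. g x \<partial>distr lborel borel (\<lambda>x. c - x))"
    by simp
  also have "\<dots> = (\<integral>\<^sup>+x. g (c - x) \<partial>lborel)"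
    by (rule nn_integral_distr) auto
  finally show ?thesis by simp
qed

text \<open>Uniqueness of Haar measure, as a double integral against the indicator of the unit ball,
  which is invariant under isometries.\<close>
lemma nn_integral_lborel_isometry:
  fixes f :: "'a::euclidean_space \<Rightarrow> 'a" and g :: "'a \<Rightarrow> ennreal"
  assumes g [measurable]: "g \<in> borel_measurable borel"
    and f: "linear f" and norm_f: "\<And>x. norm (f x) = norm x"
  shows "(\<integral>\<^sup>+x. g (f x) \<partial>lborel) = (\<integral>\<^sup>+x. g x \<partial>lborel)"
proof -
  interpret linear f by fact
  define h :: "'a \<Rightarrow> ennreal" where "h = indicator (ball 0 1)"
  have [measurable]: "h \<in> borel_measurable borel" unfolding h_def by (intro borel_measurable_indicator) simp
  have [measurable]: "f \<in> borel_measurable borel"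
    using f by (intro borel_measurable_continuous_onI linear_continuous_on linear_conv_bounded_linear[THEN iffD1])
  have "inj f"
    using norm_f by (metis injI diff eq_iff_diff_eq_0 norm_eq_zero)
  then have "surj f"
    using f linear_injective_imp_surjective by blast
  have hf: "h (f x) = h x" for x by (simp add: h_def indicator_def norm_f)
  \<comment> \<open>Substituting \<open>z + x\<close> for \<open>x\<close>, where
    \<open>y = f z\<close>, moves the shift into \<open>g\<close>; the ball is invariant under
    \<open>f\<close>, so \<open>h (f x)\<close> becomes \<open>h x\<close>.\<close>
  have shift: "(\<integral>\<^sup>+x. h (f x - y) * g (f x) \<partial>lborel) = (\<integral>\<^sup>+x. h x * g (f x + y) \<partial>lborel)" for y
  proof -
    obtain z where z: "y = f z" using \<open>surj f\<close> by blast
    have "(\<integral>\<^sup>+x. h (f x - y) * g (f x) \<partial>lborel) = (\<integral>\<^sup>+x. h (f (z + x) - y) * g (f (z + x)) \<partial>lborel)"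
      by (rule nn_integral_lborel_shift[symmetric]) measurable
    then show ?thesis by (simp add: z add hf add.commute)
  qed
  \<comment> \<open>By reflection invariance each inner integral over \<open>y\<close> is
    \<open>g (f x)\<close> times the mass of \<open>h\<close>.\<close>
  have "(\<integral>\<^sup>+x. g (f x) \<partial>lborel) * integral\<^sup>N lborel h
      = (\<integral>\<^sup>+x. (\<integral>\<^sup>+y. h (f x - y) * g (f x) \<partial>lborel) \<partial>lborel)"
    by (simp add: nn_integral_multc nn_integral_cmult nn_integral_lborel_reflect
        mult.commute[of "integral\<^sup>N lborel (\<lambda>x. g (f x))"])
  also have "\<dots> = (\<integral>\<^sup>+y. (\<integral>\<^sup>+x. h (f x - y) * g (f x) \<partial>lborel) \<partial>lborel)"
    by (rule lborel_pair.Fubini'[symmetric]) measurable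
  also have "\<dots> = (\<integral>\<^sup>+y. (\<integral>\<^sup>+x. h x * g (f x + y) \<partial>lborel) \<partial>lborel)"
    by (simp add: shift)
  also have "\<dots> = (\<integral>\<^sup>+x. (\<integral>\<^sup>+y. h x * g (f x + y) \<partial>lborel) \<partial>lborel)"
    by (rule lborel_pair.Fubini') measurable
  also have "\<dots> = (\<integral>\<^sup>+x. g x \<partial>lborel) * integral\<^sup>N lborel h"
    using nn_integral_lborel_shift[of g] by (simp add: nn_integral_cmult nn_integral_multc mult.commute)
  finally have eq: "(\<integral>\<^sup>+x. g (f x) \<partial>lborel) * integral\<^sup>N lborel h
     = (\<integral>\<^sup>+x. g x \<partial>lborel) * integral\<^sup>N lborel h" .
  \<comment> \<open>The ball has finite nonzero volume, so this factor cancels in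
    \<open>ennreal\<close>.\<close>
  have "integral\<^sup>N lborel h = emeasure lborel (ball (0::'a) 1)" by (simp add: h_def)
  moreover have "emeasure lborel (ball (0::'a) 1) < \<infinity>" by (rule emeasure_lborel_ball_finite)
  moreover have "emeasure lborel (ball (0::'a) 1) \<noteq> 0"
    using content_ball_pos[of 1 "0::'a"] by (auto simp: measure_def)
  ultimately show ?thesis
    using eq by (auto simp: ennreal_mult_cancel_left mult.commute[of _ "emeasure lborel (ball (0::'a) 1)"])
qed

text \<open>Adjoining an orthonormal basis of the orthogonal complement completes \<open>B\<close>
  to an orthonormal basis, and matching it with \<open>Basis\<close> defines the isometry. It serves
  to turn a cylinder over an arbitrary orthonormal family into one over standard
  coordinates.\<close>

lemma orthonormal_set_isometry:
  fixes B :: "'a::euclidean_space set"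
  assumes orth: "pairwise orthogonal B" and norm_B: "\<And>x. x \<in> B \<Longrightarrow> norm x = 1"
  obtains g :: "'a \<Rightarrow> 'a" and C
  where "linear g" "\<And>x. norm (g x) = norm x" "C \<subseteq> Basis" "bij_betw g C B"
proof -
  have ortho_indep: "independent E" if "pairwise orthogonal E" "\<And>x. x \<in> E \<Longrightarrow> norm x = 1"
    for E :: "'a set"
    using that by (metis norm_zero pairwise_orthogonal_independent zero_neq_one)
  define P where "P = {y. \<forall>x\<in>span B. orthogonal x y}"
  have "subspace P" unfolding P_def by (rule subspace_orthogonal_to_vectors)
  then obtain B' where B': "B' \<subseteq> P" "pairwise orthogonal B'" "\<And>x. x \<in> B' \<Longrightarrow> norm x = 1"
      "card B' = dim P" "independent B'"
    using orthonormal_basis_subspace by metis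
  define E where "E = B \<union> B'"
  have cross: "orthogonal x y" if "x \<in> B" "y \<in> B'" for x y
    using that B'(1) by (auto simp: P_def span_base)
  have E: "pairwise orthogonal E" "\<And>x. x \<in> E \<Longrightarrow> norm x = 1"
    using orth B'(2,3) norm_B cross cross[THEN orthogonal_commute[THEN iffD1]]
    unfolding E_def pairwise_def by blast+
  have fin: "finite B" "finite B'" "finite E"
    using ortho_indep[OF orth norm_B] B'(5) by (auto simp: E_def independent_imp_finite)
  have "B \<inter> B' = {}"
  proof -
    have False if "x \<in> B" "x \<in> B'" for x
      using cross[OF that] norm_B[OF that(1)] by (simp add: orthogonal_self)
    then show ?thesis by blast
  qed
  moreover have "dim P + dim (span B) = dim (UNIV :: 'a set)"
    using dim_subspace_orthogonal_to_vectors[of "span B" UNIV] by (simp add: P_def)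
  moreover have "dim (span B) = card B"
    using ortho_indep[OF orth norm_B] by (simp add: dim_eq_card_independent)
  ultimately have "card E = card (Basis :: 'a set)"
    using fin B'(4) by (simp add: E_def card_Un_disjoint)
  then obtain \<pi> where \<pi>: "bij_betw \<pi> (Basis :: 'a set) E"
    using fin finite_same_card_bij[OF finite_Basis fin(3)] by auto
  have \<pi>E: "\<pi> b \<in> E" if "b \<in> Basis" for b using \<pi> that by (auto simp: bij_betw_def)
  have \<pi>inj: "\<pi> b = \<pi> b' \<longleftrightarrow> b = b'" if "b \<in> Basis" "b' \<in> Basis" for b b'
    using \<pi> that by (auto simp: bij_betw_def inj_on_def)
  define g :: "'a \<Rightarrow> 'a" where "g x = (\<Sum>b\<in>Basis. (x \<bullet> b) *\<^sub>R \<pi> b)" for x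
  have inner_\<pi>: "\<pi> b \<bullet> \<pi> b' = (if b = b' then 1 else 0)" if "b \<in> Basis" "b' \<in> Basis" for b b'
    using E \<pi>E[OF that(1)] \<pi>E[OF that(2)] \<pi>inj[OF that]
    by (auto simp: pairwise_def orthogonal_def norm_eq_1)
  have "linear g"
    by (rule linearI) (simp_all add: g_def inner_add_left scaleR_add_left sum.distrib scaleR_sum_right)
  moreover have "norm (g x) = norm x" for x
  proof -
    have "g x \<bullet> g x = (\<Sum>b\<in>Basis. \<Sum>b'\<in>Basis. (x \<bullet> b) * ((x \<bullet> b') * (\<pi> b' \<bullet> \<pi> b)))"
      by (simp add: g_def inner_sum_left inner_sum_right sum_distrib_left)
    also have "\<dots> = (\<Sum>b\<in>Basis. \<Sum>b'\<in>Basis. if b = b' then (x \<bullet> b) * (x \<bullet> b') else 0)"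
      by (intro sum.cong refl) (simp add: inner_\<pi>)
    also have "\<dots> = x \<bullet> x"
      by (simp add: sum.delta euclidean_inner[of x x])
    finally show ?thesis by (simp add: norm_eq_sqrt_inner)
  qed
  moreover have g\<pi>: "g b = \<pi> b" if "b \<in> Basis" for b
  proof -
    have "g b = (\<Sum>b'\<in>Basis. if b' = b then \<pi> b' else 0)"
      unfolding g_def using that by (intro sum.cong refl) (simp add: inner_Basis)
    then show ?thesis using that by simp
  qed
  define C where "C = {b \<in> Basis. \<pi> b \<in> B}"
  have "bij_betw g C B"
    unfolding bij_betw_def
  proof
    show "inj_on g C" by (auto simp: inj_on_def C_def g\<pi> \<pi>inj)
    have "\<pi> ` C = B" using \<pi> by (force simp: C_def bij_betw_def E_def)
    then show "g ` C = B" by (force simp: C_def g\<pi>)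
  qed
  moreover have "C \<subseteq> Basis" by (auto simp: C_def)
  ultimately show ?thesis using that by blast
qed

section \<open>Gaussian measure of cylinders\<close>

lemma nn_integral_powr_Icc:
  assumes "0 < p" "0 \<le> c"
  shows "(\<integral>\<^sup>+x. ennreal (indicator {0..} x * (p * x powr (p - 1))) * indicator {..c} x \<partial>lborel) = ennreal (c powr p)"
proof -
  have "((\<lambda>x. x powr (p - 1)) has_integral (c powr p / p)) {0..c}"
    using has_integral_powr_from_0[of "p - 1" c] assms by simp
  from has_integral_mult_right[OF this, of p]
  have "((\<lambda>x. p * x powr (p - 1)) has_integral c powr p) {0..c}"
    using assms by simp
  from nn_integral_has_integral_lebesgue[OF _ this]
  have "(\<integral>\<^sup>+x. ennreal (indicator {0..c} x * (p * x powr (p - 1))) \<partial>lborel) = ennreal (c powr p)"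
    using assms by simp
  moreover have "ennreal (indicator {0..} x * (p * x powr (p - 1))) * indicator {..c} x
     = ennreal (indicator {0..c} x * (p * x powr (p - 1)))" for x :: real
    by (auto simp: indicator_def)
  ultimately show ?thesis by simp
qed

text \<open>The sublevel set at a level \<open>a > 0\<close> is a Euclidean ball of radius
  \<open>sqrt (c * a)\<close>, whose volume is proportional to \<open>a powr p\<close>; the density
  is the derivative of this volume. Both measures are infinite, so uniqueness is obtained through
  the exhaustion by the half-lines \<open>{..real n}\<close>, which have finite measure.\<close>

lemma distr_sum_squares_lborel:
  fixes A :: "'i set" and c :: real
  assumes "finite A" "A \<noteq> {}" "c > 0"
  defines "p \<equiv> real (card A) / 2"
  shows "distr (\<Pi>\<^sub>M i\<in>A. lborel) borel (\<lambda>f. (\<Sum>i\<in>A. (f i)\<^sup>2) / c)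
    = density lborel (\<lambda>s. ennreal (unit_ball_vol (card A) * c powr p)
        * ennreal (indicator {0..} s * (p * s powr (p - 1))))"  (is "?M = ?N")
proof (rule measure_eqI_generator_eq_countable[where E = "range atMost" and \<Omega> = UNIV and A = "range (\<lambda>n::nat. {..real n})"])
  let ?V = "unit_ball_vol (card A)"
  have p: "0 < p" using assms by (simp add: p_def card_gt_0_iff)
  have M: "emeasure ?M {..a} = ennreal (?V * (c * a) powr p)" if "a > 0" for a
  proof -
    have "emeasure ?M {..a} = emeasure (\<Pi>\<^sub>M i\<in>A. lborel)
        ({f. sqrt (\<Sum>i\<in>A. (f i)\<^sup>2) \<le> sqrt (c * a)} \<inter> space (\<Pi>\<^sub>M i\<in>A. lborel))"
      using assms by (subst emeasure_distr) (auto simp: field_simps intro!: arg_cong2[where f=emeasure])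
    also have "\<dots> = ennreal (?V * sqrt (c * a) ^ card A)"
      using assms that by (subst emeasure_cball_aux) auto
    also have "sqrt (c * a) ^ card A = (c * a) powr p"
      using assms that by (simp add: p_def powr_half_sqrt[symmetric] powr_realpow[symmetric] powr_powr)
    finally show ?thesis .
  qed
  have N: "emeasure ?N {..a} = ennreal (?V * c powr p * (max 0 a) powr p)" for a
  proof -
    have "emeasure ?N {..a} = ennreal (?V * c powr p) *
       (\<integral>\<^sup>+x. ennreal (indicator {0..} x * (p * x powr (p - 1))) * indicator {..a} x \<partial>lborel)"
      by (simp add: emeasure_density mult.assoc nn_integral_cmult)
    also have "(\<integral>\<^sup>+x. ennreal (indicator {0..} x * (p * x powr (p - 1))) * indicator {..a} x \<partial>lborel)
      = (\<integral>\<^sup>+x. ennreal (indicator {0..} x * (p * x powr (p - 1))) * indicator {..max 0 a} x \<partial>lborel)"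
    \<comment> \<open>For negative \<open>a\<close> the two truncations can differ only at the point
      0, a null set.\<close>
    proof (rule nn_integral_cong_AE)
      have "AE x in lborel. x \<noteq> (0::real)" by (rule AE_lborel_singleton)
      then show "AE x in lborel. ennreal (indicator {0..} x * (p * x powr (p - 1))) * indicator {..a} x
        = ennreal (indicator {0..} x * (p * x powr (p - 1))) * indicator {..max 0 a} x"
        by eventually_elim (auto simp: indicator_def)
    qed
    also have "\<dots> = ennreal (max 0 a powr p)" using p by (intro nn_integral_powr_Icc) auto
    finally show ?thesis by (simp add: ennreal_mult)
  qed
  show "emeasure ?M X = emeasure ?N X" if X: "X \<in> range atMost" for X
  proof -
    from X obtain a where a: "X = {..a}" by auto
    show ?thesis
    proof (cases "a > 0")
      case True
      then show ?thesis
        unfolding a M[OF True] N using \<open>c > 0\<close> by (simp add: powr_mult mult_ac max_absorb2)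
    next
      case False
      \<comment> \<open>The ball volume \<open>M\<close> covers positive levels only. For
        \<open>a \<le> 0\<close> the half-line lies in every \<open>{..e}\<close> with
        \<open>e > 0\<close>, and letting \<open>e\<close> tend to 0 squeezes its mass to 0.\<close>
      have "emeasure ?M X \<le> ennreal (?V * (c * e) powr p)" if "e > 0" for e
        using emeasure_mono[of X "{..e}" ?M] False a that by (simp add: M)
      then have "emeasure ?M X \<le> 0"
      proof (intro tendsto_lowerbound[where F = "at_right 0" and f = "\<lambda>e. ennreal (?V * (c * e) powr p)"])
        have "\<forall>\<^sub>F e in at_right 0. 0 \<le> c * e"
          using eventually_at_right_less[of 0] by eventually_elim (use \<open>c > 0\<close> in simp)
        then have "((\<lambda>e. ?V * (c * e) powr p) \<longlongrightarrow> ?V * (c * 0) powr p) (at_right 0)"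
          using p assms by (intro tendsto_intros tendsto_powr2) auto
        then show "((\<lambda>e. ennreal (?V * (c * e) powr p)) \<longlongrightarrow> 0) (at_right 0)"
          using p by (auto dest: tendsto_ennrealI)
      qed (auto simp: eventually_at_right_less intro: eventually_mono[OF eventually_at_right_less])
      then show ?thesis using False p by (simp add: a N max_absorb1)
    qed
  qed
  show "sets ?M = sigma_sets UNIV (range atMost)" "sets ?N = sigma_sets UNIV (range atMost)"
    by (simp_all add: borel_eq_atMost sets_measure_of[symmetric])
  show "Int_stable (range atMost :: real set set)" by (auto simp: Int_stable_def)
  show "range (\<lambda>n::nat. {..real n}) \<subseteq> range atMost" by auto
  show "\<Union> (range (\<lambda>n::nat. {..real n})) = UNIV"
    using real_arch_simple by auto
  show "emeasure ?M X \<noteq> \<infinity>" if "X \<in> range (\<lambda>n::nat. {..real n})" for X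
  proof -
    from that obtain n where X: "X = {..real n}" by auto
    \<comment> \<open>\<open>real n\<close> may be 0, where \<open>M\<close> does not apply; hence
      the passage to \<open>Suc n\<close>.\<close>
    have "emeasure ?M X \<le> emeasure ?M {..real (Suc n)}"
      unfolding X by (intro emeasure_mono) auto
    also have "\<dots> < \<infinity>" by (simp add: M del: of_nat_Suc)
    finally show ?thesis by simp
  qed
qed auto


text \<open>The Euler integral for \<open>Gamma p\<close> splits at \<open>T\<close>; the interval
  is half-open because \<open>upper_inc_Gamma\<close> integrates over the closed ray.\<close>

lemma upper_inc_Gamma_complement:
  assumes "0 < p" "0 \<le> T"
  shows "(\<integral>\<^sup>+s. ennreal (indicator {0..<T} s * (s powr (p - 1) * exp (- s))) \<partial>lborel)
    = ennreal (Gamma p - upper_inc_Gamma p T)"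
proof -
  let ?g = "\<lambda>s. s powr (p - 1) * exp (- s) :: real"
  have total: "(\<integral>\<^sup>+s. ennreal (indicator {0..} s * ?g s) \<partial>lborel) = ennreal (Gamma p)"
    using Gamma_conv_nn_integral_real[OF assms(1)] by (simp add: exp_minus field_simps)
  have split: "ennreal (indicator {0..} s * ?g s)
      = ennreal (indicator {0..<T} s * ?g s) + ennreal (indicator {T..} s * ?g s)" for s
    using assms(2) by (auto simp: indicator_def)
  have sum: "(\<integral>\<^sup>+s. ennreal (indicator {0..<T} s * ?g s) \<partial>lborel)
      + (\<integral>\<^sup>+s. ennreal (indicator {T..} s * ?g s) \<partial>lborel) = ennreal (Gamma p)"
    unfolding total[symmetric] split by (subst nn_integral_add) auto
  have upper: "(\<integral>\<^sup>+s. ennreal (indicator {T..} s * ?g s) \<partial>lborel) = ennreal (upper_inc_Gamma p T)"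
  proof -
    have "integral\<^sup>L lborel (\<lambda>s. indicator {T..} s * ?g s)
       = enn2real (\<integral>\<^sup>+s. ennreal (indicator {T..} s * ?g s) \<partial>lborel)"
      by (rule integral_eq_nn_integral) auto
    then have "upper_inc_Gamma p T = enn2real (\<integral>\<^sup>+s. ennreal (indicator {T..} s * ?g s) \<partial>lborel)"
      by (simp add: upper_inc_Gamma_def set_lebesgue_integral_def)
    \<comment> \<open>Finiteness matters: \<open>enn2real\<close> sends infinity to 0, so converting
      back to \<open>ennreal\<close> is faithful only below \<open>top\<close>.\<close>
    moreover have "(\<integral>\<^sup>+s. ennreal (indicator {T..} s * ?g s) \<partial>lborel) < top"
    proof -
      have "(\<integral>\<^sup>+s. ennreal (indicator {T..} s * ?g s) \<partial>lborel) \<le> ennreal (Gamma p)"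
        unfolding sum[symmetric] by (rule le_iff_add[THEN iffD2]) (auto simp: add.commute)
      then show ?thesis by (rule order_le_less_trans) simp
    qed
    ultimately show ?thesis by simp
  qed
  have nonneg: "0 \<le> upper_inc_Gamma p T"
    unfolding upper_inc_Gamma_def set_lebesgue_integral_def
    by (intro integral_nonneg_AE) auto
  have "(\<integral>\<^sup>+s. ennreal (indicator {0..<T} s * ?g s) \<partial>lborel) = ennreal (Gamma p) - ennreal (upper_inc_Gamma p T)"
    unfolding sum[symmetric] upper by (rule ennreal_add_diff_cancel_right[symmetric]) simp
  then show ?thesis using nonneg by (simp add: ennreal_minus)
qed


text \<open>Let \<open>s\<close> be the squared length divided by \<open>c\<close>. In this variable
  the Gaussian density is a constant times \<open>exp (- s)\<close>, and Lebesgue measure pushes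
  forward to a multiple of \<open>s powr (p - 1)\<close> on the positive half-line. The ball becomes
  \<open>s < T\<close>, which leaves a lower incomplete Gamma integral.\<close>

lemma chi_square_ball:
  fixes A :: "'i set" and \<sigma> R :: real
  assumes "finite A" "A \<noteq> {}" "\<sigma> > 0" "R > 0"
  shows "(\<integral>\<^sup>+f. ennreal (\<Prod>i\<in>A. normal_density 0 \<sigma> (f i)) * indicator {f. (\<Sum>i\<in>A. (f i)\<^sup>2) < R\<^sup>2} f \<partial>(\<Pi>\<^sub>M i\<in>A. lborel))
    = ennreal (I_k (card A) R (1 / \<sigma>\<^sup>2))"
proof -
  define k where "k = card A"
  define c where "c = 2 * \<sigma>\<^sup>2"
  define p where "p = real k / 2"
  define T where "T = R\<^sup>2 / 2 * (1 / \<sigma>\<^sup>2)"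
  have k: "k \<noteq> 0" using assms by (simp add: k_def)
  have p: "0 < p" using k by (simp add: p_def)
  have c: "0 < c" using assms by (simp add: c_def)
  have T: "0 \<le> T" by (simp add: T_def)
  define C where "C = (1 / sqrt (pi * c)) ^ k"
  define G where "G s = ennreal (C * exp (- s)) * indicator {..<T} s" for s :: real
  have density: "(\<Prod>i\<in>A. normal_density 0 \<sigma> (f i)) = C * exp (- ((\<Sum>i\<in>A. (f i)\<^sup>2) / c))" for f
  proof -
    have "(\<Prod>i\<in>A. normal_density 0 \<sigma> (f i))
        = (\<Prod>i\<in>A. 1 / sqrt (pi * c)) * (\<Prod>i\<in>A. exp (- ((f i)\<^sup>2 / c)))"
      unfolding prod.distrib[symmetric]
      by (intro prod.cong refl) (simp add: normal_density_def c_def mult_ac)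
    also have "(\<Prod>i\<in>A. exp (- ((f i)\<^sup>2 / c))) = exp (- ((\<Sum>i\<in>A. (f i)\<^sup>2) / c))"
      using assms(1) by (simp add: exp_sum[symmetric] sum_negf sum_divide_distrib)
    finally show ?thesis by (simp add: C_def k_def)
  qed
  have ball: "(\<Sum>i\<in>A. (f i)\<^sup>2) < R\<^sup>2 \<longleftrightarrow> (\<Sum>i\<in>A. (f i)\<^sup>2) / c < T" for f
    using assms by (simp add: T_def c_def field_simps)
  \<comment> \<open>The powers of \<open>pi * c\<close> cancel and
    \<open>Gamma (p + 1) = p * Gamma p\<close> absorbs the factor \<open>p\<close>, which leaves
    exactly the normalisation in \<open>I_k\<close>.\<close>
  have const: "C * (unit_ball_vol k * c powr p) * p = 1 / Gamma p"
  proof -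
    have "Gamma (p + 1) = p * Gamma p"
      using p by (subst Gamma_plus1) auto
    moreover have "C = (pi * c) powr (- p)"
    proof -
      have "1 / sqrt (pi * c) = (pi * c) powr (- (1 / 2))"
        using c by (simp add: powr_minus_divide powr_half_sqrt)
      then show ?thesis
        using c by (simp add: C_def p_def powr_power)
    qed
    moreover have "unit_ball_vol k = pi powr p / Gamma (p + 1)"
      by (simp add: unit_ball_vol_def p_def)
    ultimately have "C * (unit_ball_vol k * c powr p) * p
        = ((pi * c) powr (- p) * (pi * c) powr p) * (p / (p * Gamma p))"
      using c by (simp add: powr_mult)
    also have "(pi * c) powr (- p) * (pi * c) powr p = 1"
      using c by (simp add: powr_add[symmetric])
    finally show ?thesis using p by simp
  qed
  have [measurable]: "G \<in> borel_measurable borel" unfolding G_def by measurable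
  have "(\<integral>\<^sup>+f. ennreal (\<Prod>i\<in>A. normal_density 0 \<sigma> (f i)) * indicator {f. (\<Sum>i\<in>A. (f i)\<^sup>2) < R\<^sup>2} f \<partial>(\<Pi>\<^sub>M i\<in>A. lborel))
     = (\<integral>\<^sup>+f. G ((\<Sum>i\<in>A. (f i)\<^sup>2) / c) \<partial>(\<Pi>\<^sub>M i\<in>A. lborel))"
    by (simp add: G_def density indicator_def ball)
  also have "\<dots> = (\<integral>\<^sup>+s. G s \<partial>distr (\<Pi>\<^sub>M i\<in>A. lborel) borel (\<lambda>f. (\<Sum>i\<in>A. (f i)\<^sup>2) / c))"
    by (rule nn_integral_distr[symmetric]) auto
  also have "\<dots> = (\<integral>\<^sup>+s. (ennreal (unit_ball_vol k * c powr p)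
        * ennreal (indicator {0..} s * (p * s powr (p - 1)))) * G s \<partial>lborel)"
    unfolding distr_sum_squares_lborel[OF assms(1,2) c] k_def[symmetric] p_def[symmetric]
    by (rule nn_integral_density) auto
  also have "\<dots> = (\<integral>\<^sup>+s. ennreal (1 / Gamma p) * ennreal (indicator {0..<T} s * (s powr (p - 1) * exp (- s))) \<partial>lborel)"
  proof (intro nn_integral_cong)
    fix s :: real
    have "C \<ge> 0" using c by (simp add: C_def)
    show "(ennreal (unit_ball_vol k * c powr p)
        * ennreal (indicator {0..} s * (p * s powr (p - 1)))) * G s
      = ennreal (1 / Gamma p) * ennreal (indicator {0..<T} s * (s powr (p - 1) * exp (- s)))"
      unfolding const[symmetric] G_def using p c \<open>C \<ge> 0\<close>
      by (auto simp: indicator_def ennreal_mult'[symmetric] mult_ac)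
  qed
  also have "\<dots> = ennreal (1 / Gamma p) * ennreal (Gamma p - upper_inc_Gamma p T)"
    using upper_inc_Gamma_complement[OF p T] by (simp add: nn_integral_cmult)
  also have "\<dots> = ennreal (1 - upper_inc_Gamma p T / Gamma p)"
    using p by (simp add: ennreal_mult'[symmetric] diff_divide_distrib Gamma_real_pos less_imp_neq[symmetric])
  finally show ?thesis
    using k by (simp add: I_k_def k_def[symmetric] p_def T_def)
qed

section \<open>Cylinders over coordinate axes\<close>

lemma nn_integral_normal_density:
  assumes "\<sigma> > 0"
  shows "(\<integral>\<^sup>+x. ennreal (normal_density 0 \<sigma> x) \<partial>lborel) = 1"
  using prob_space.emeasure_space_1[OF prob_space_normal_density[OF assms, of 0]]
  by (simp add: emeasure_density)

text \<open>The density is a product and the cylinder constrains only the coordinates in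
  \<open>C\<close>. By Fubini the other coordinates integrate to 1, and a centred ball in
  \<open>card C\<close> dimensions remains.\<close>

lemma normal_cylinder_Basis:
  fixes C :: "'a::euclidean_space set"
  assumes C: "C \<subseteq> Basis" "C \<noteq> {}" and "\<sigma> > 0" "R > 0"
  shows "(\<integral>\<^sup>+w. ennreal (\<Prod>b\<in>Basis. normal_density 0 \<sigma> (w \<bullet> b))
      * indicator {w. (\<Sum>b\<in>C. (w \<bullet> b)\<^sup>2) < R\<^sup>2} w \<partial>(lborel :: 'a measure))
    = ennreal (I_k (card C) R (1 / \<sigma>\<^sup>2))"
proof -
  interpret product_sigma_finite "\<lambda>_::'a. lborel :: real measure" ..
  let ?nd = "normal_density 0 \<sigma>"
  define D where "D = Basis - C"
  have CD: "C \<inter> D = {}" "finite C" "finite D" "C \<union> D = Basis"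
    using C finite_subset[OF C(1)] by (auto simp: D_def)
  have inner: "(\<Sum>b'\<in>Basis. f b' *\<^sub>R b') \<bullet> b = f b" if "b \<in> Basis" for b :: 'a and f
    using that by (simp add: inner_sum_left inner_Basis if_distrib[of "(*) _"] cong: if_cong)
  have "(\<integral>\<^sup>+w. ennreal (\<Prod>b\<in>Basis. ?nd (w \<bullet> b)) * indicator {w. (\<Sum>b\<in>C. (w \<bullet> b)\<^sup>2) < R\<^sup>2} w \<partial>(lborel :: 'a measure))
    = (\<integral>\<^sup>+f. ennreal (\<Prod>b\<in>Basis. ?nd ((\<Sum>b\<in>Basis. f b *\<^sub>R b) \<bullet> b))
        * indicator {w. (\<Sum>b\<in>C. (w \<bullet> b)\<^sup>2) < R\<^sup>2} (\<Sum>b\<in>Basis. f b *\<^sub>R b) \<partial>(\<Pi>\<^sub>M b\<in>Basis. lborel))"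
    by (subst lborel_eq, rule nn_integral_distr) measurable
  also have "\<dots> = (\<integral>\<^sup>+f. ennreal (\<Prod>b\<in>Basis. ?nd (f b)) * indicator {f. (\<Sum>b\<in>C. (f b)\<^sup>2) < R\<^sup>2} f
       \<partial>(\<Pi>\<^sub>M b\<in>C \<union> D. lborel))"
  proof -
    have "(\<Sum>b\<in>C. ((\<Sum>b'\<in>Basis. f b' *\<^sub>R b') \<bullet> b)\<^sup>2) = (\<Sum>b\<in>C. (f b)\<^sup>2)" for f
      using C(1) by (intro sum.cong refl) (simp add: inner subset_iff)
    then show ?thesis by (simp add: CD(4) inner indicator_def cong: prod.cong)
  qed
  also have "\<dots> = (\<integral>\<^sup>+x. (\<integral>\<^sup>+y. ennreal (\<Prod>b\<in>Basis. ?nd (merge C D (x, y) b))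
      * indicator {f. (\<Sum>b\<in>C. (f b)\<^sup>2) < R\<^sup>2} (merge C D (x, y)) \<partial>(\<Pi>\<^sub>M b\<in>D. lborel)) \<partial>(\<Pi>\<^sub>M b\<in>C. lborel))"
  proof (rule product_nn_integral_fold[OF CD(1-3)])
    have comp: "(\<lambda>f :: 'a \<Rightarrow> real. f b) \<in> borel_measurable (\<Pi>\<^sub>M b\<in>C \<union> D. lborel)" if "b \<in> Basis" for b :: 'a
      using that measurable_component_singleton[of b "C \<union> D" "\<lambda>_. lborel"] by (simp add: CD(4))
    have "(\<lambda>f :: 'a \<Rightarrow> real. \<Sum>b\<in>C. (f b)\<^sup>2) \<in> borel_measurable (\<Pi>\<^sub>M b\<in>C \<union> D. lborel)"
      using C(1) by (intro borel_measurable_sum borel_measurable_power comp) auto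
    then have "(\<lambda>f :: 'a \<Rightarrow> real. indicator {..<R\<^sup>2} (\<Sum>b\<in>C. (f b)\<^sup>2) :: ennreal) \<in> borel_measurable (\<Pi>\<^sub>M b\<in>C \<union> D. lborel)"
      by measurable
    then show "(\<lambda>f. ennreal (\<Prod>b\<in>Basis. ?nd (f b)) * indicator {f. (\<Sum>b\<in>C. (f b)\<^sup>2) < R\<^sup>2} f)
       \<in> borel_measurable (\<Pi>\<^sub>M b\<in>C \<union> D. lborel)"
      by (intro borel_measurable_times_ennreal measurable_compose[OF _ measurable_ennreal] borel_measurable_prod
           measurable_compose[OF comp borel_measurable_normal_density])
        (simp_all add: indicator_def)
  qed
  also have "\<dots> = (\<integral>\<^sup>+x. ennreal (\<Prod>b\<in>C. ?nd (x b)) * indicator {f. (\<Sum>b\<in>C. (f b)\<^sup>2) < R\<^sup>2} x \<partial>(\<Pi>\<^sub>M b\<in>C. lborel))"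
  proof (intro nn_integral_cong)
    fix x :: "'a \<Rightarrow> real"
    have [simp]: "merge C D (x, y) b = x b" if "b \<in> C" for y b using that by (simp add: merge_def)
    have [simp]: "merge C D (x, y) b = y b" if "b \<in> D" for y b using that CD(1) by (auto simp: merge_def)
    have split: "\<And>y. ennreal (\<Prod>b\<in>Basis. ?nd (merge C D (x, y) b)) = ennreal (\<Prod>b\<in>C. ?nd (x b)) * (\<Prod>b\<in>D. ennreal (?nd (y b)))"
      unfolding CD(4)[symmetric] using CD(1-3)
      by (simp add: prod.union_disjoint ennreal_mult' prod_ennreal prod_nonneg)
    have ind: "indicator {f. (\<Sum>b\<in>C. (f b)\<^sup>2) < R\<^sup>2} (merge C D (x, y)) = (indicator {f. (\<Sum>b\<in>C. (f b)\<^sup>2) < R\<^sup>2} x :: ennreal)" for y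
      by (simp add: indicator_def)
    have "(\<integral>\<^sup>+y. (\<Prod>b\<in>D. ennreal (?nd (y b))) \<partial>(\<Pi>\<^sub>M b\<in>D. lborel)) = 1"
      using product_nn_integral_prod[OF CD(3), of "\<lambda>_ x. ennreal (?nd x)"] \<open>\<sigma> > 0\<close>
      by (simp add: nn_integral_normal_density)
    moreover have "(\<lambda>y. \<Prod>b\<in>D. ennreal (?nd (y b))) \<in> borel_measurable (\<Pi>\<^sub>M b\<in>D. lborel)"
      by measurable
    ultimately show "(\<integral>\<^sup>+y. ennreal (\<Prod>b\<in>Basis. ?nd (merge C D (x, y) b))
      * indicator {f. (\<Sum>b\<in>C. (f b)\<^sup>2) < R\<^sup>2} (merge C D (x, y)) \<partial>(\<Pi>\<^sub>M b\<in>D. lborel))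
      = ennreal (\<Prod>b\<in>C. ?nd (x b)) * indicator {f. (\<Sum>b\<in>C. (f b)\<^sup>2) < R\<^sup>2} x"
      unfolding split ind by (simp add: nn_integral_cmult nn_integral_multc)
  qed
  also have "\<dots> = ennreal (I_k (card C) R (1 / \<sigma>\<^sup>2))"
    using assms CD by (intro chi_square_ball) auto
  finally show ?thesis .
qed

section \<open>The noise law and its rotation invariance\<close>

lemma noise_density_Basis:
  fixes w :: "real^'n"
  shows "noise_density \<sigma> w = (\<Prod>b\<in>Basis. normal_density 0 \<sigma> (w \<bullet> b))"
proof -
  have Basis: "(Basis :: (real^'n) set) = range (\<lambda>i. axis i 1)"
    by (auto simp: Basis_vec_def)
  have inj: "inj (\<lambda>i::'n. axis i (1::real))"
    by (auto simp: inj_on_def axis_eq_axis)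
  show ?thesis
    unfolding Basis by (simp add: noise_density_def prod.reindex[OF inj] inner_axis)
qed

text \<open>Dependence on \<open>norm w\<close> alone gives both the rotation invariance of the
  noise and the identification of maximum likelihood with minimum distance.\<close>

lemma noise_density_norm:
  fixes w :: "real^'n"
  shows "noise_density \<sigma> w = (1 / sqrt (2 * pi * \<sigma>\<^sup>2)) ^ CARD('n) * exp (- ((norm w)\<^sup>2 / (2 * \<sigma>\<^sup>2)))"
proof -
  have "noise_density \<sigma> w = (\<Prod>i\<in>(UNIV::'n set). 1 / sqrt (2 * pi * \<sigma>\<^sup>2))
      * (\<Prod>i\<in>UNIV. exp (- ((w $ i)\<^sup>2 / (2 * \<sigma>\<^sup>2))))"
    unfolding noise_density_def prod.distrib[symmetric]
    by (intro prod.cong refl) (simp add: normal_density_def)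
  also have "(\<Prod>i\<in>UNIV. exp (- ((w $ i)\<^sup>2 / (2 * \<sigma>\<^sup>2)))) = exp (- ((norm w)\<^sup>2 / (2 * \<sigma>\<^sup>2)))"
    by (simp add: exp_sum[symmetric] sum_negf sum_divide_distrib norm_vec_def L2_set_def sum_nonneg)
  finally show ?thesis by simp
qed

lemma borel_measurable_noise_density [measurable]: "noise_density \<sigma> \<in> borel_measurable borel"
  unfolding noise_density_def by measurable

lemma sets_noise [simp, measurable_cong]: "sets (noise \<sigma>) = sets borel"
  and space_noise [simp]: "space (noise \<sigma>) = UNIV"
  by (simp_all add: noise_def)

lemma prob_space_noise:
  assumes "\<sigma> > 0"
  shows "prob_space (noise \<sigma> :: (real^'n) measure)"
proof
  have "emeasure (noise \<sigma> :: (real^'n) measure) (space (noise \<sigma>))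
      = (\<integral>\<^sup>+w. (\<Prod>b\<in>Basis. ennreal (normal_density 0 \<sigma> (w \<bullet> b))) \<partial>(lborel :: (real^'n) measure))"
    by (simp add: noise_def emeasure_density noise_density_Basis prod_ennreal)
  also have "\<dots> = (\<Prod>b\<in>(Basis :: (real^'n) set). \<integral>\<^sup>+x. ennreal (normal_density 0 \<sigma> x) \<partial>lborel)"
    by (rule nn_integral_lborel_prod) auto
  finally show "emeasure (noise \<sigma> :: (real^'n) measure) (space (noise \<sigma>)) = 1"
    using assms by (simp add: nn_integral_normal_density)
qed

text \<open>The isometry \<open>g\<close> aligns part of the standard basis with \<open>B\<close>
  and preserves the noise density, so the coordinate case applies. Empty \<open>B\<close> is treated
  apart: there \<open>I_k\<close> is 1 by convention, while the chi-square computation assumes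
  positive dimension.\<close>

lemma noise_cylinder:
  fixes B :: "(real^'n) set"
  assumes orth: "pairwise orthogonal B" "\<And>x. x \<in> B \<Longrightarrow> norm x = 1"
    and \<sigma>: "\<sigma> > 0" and R: "R > 0"
  shows "emeasure (noise \<sigma>) {w. (\<Sum>e\<in>B. (w \<bullet> e)\<^sup>2) < R\<^sup>2} = ennreal (I_k (card B) R (1 / \<sigma>\<^sup>2))"
proof (cases "B = {}")
  case True
  interpret prob_space "noise \<sigma> :: (real^'n) measure" by (rule prob_space_noise[OF \<sigma>])
  from True show ?thesis using R emeasure_space_1 by (simp add: I_k_def)
next
  case False
  obtain g :: "real^'n \<Rightarrow> real^'n" and C where g: "linear g" "\<And>x. norm (g x) = norm x" and C: "C \<subseteq> Basis" "bij_betw g C B"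
    by (rule orthonormal_set_isometry[OF orth]) (assumption, rule that)
  have "orthogonal_transformation g"
    using g by (simp add: orthogonal_transformation)
  then have inner: "g x \<bullet> g y = x \<bullet> y" for x y
    by (simp add: orthogonal_transformation_def)
  have "C \<noteq> {}" using C(2) False by (auto simp: bij_betw_def)
  have sum: "(\<Sum>e\<in>B. (g w \<bullet> e)\<^sup>2) = (\<Sum>b\<in>C. (w \<bullet> b)\<^sup>2)" for w
    by (simp add: sum.reindex_bij_betw[OF C(2), symmetric] inner)
  have "{w :: real^'n. (\<Sum>e\<in>B. (w \<bullet> e)\<^sup>2) < R\<^sup>2} \<in> sets borel" by measurable
  then have "emeasure (noise \<sigma>) {w. (\<Sum>e\<in>B. (w \<bullet> e)\<^sup>2) < R\<^sup>2}
    = (\<integral>\<^sup>+w. ennreal (noise_density \<sigma> w) * indicator {w. (\<Sum>e\<in>B. (w \<bullet> e)\<^sup>2) < R\<^sup>2} w \<partial>lborel)"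
    unfolding noise_def by (subst emeasure_density) auto
  also have "\<dots> = (\<integral>\<^sup>+w. ennreal (noise_density \<sigma> (g w)) * indicator {w. (\<Sum>e\<in>B. (w \<bullet> e)\<^sup>2) < R\<^sup>2} (g w) \<partial>lborel)"
    by (rule nn_integral_lborel_isometry[symmetric, OF _ g]) measurable
  also have "\<dots> = (\<integral>\<^sup>+w. ennreal (\<Prod>b\<in>Basis. normal_density 0 \<sigma> (w \<bullet> b))
      * indicator {w. (\<Sum>b\<in>C. (w \<bullet> b)\<^sup>2) < R\<^sup>2} w \<partial>lborel)"
    by (simp add: noise_density_norm g(2) sum indicator_def flip: noise_density_Basis)
  also have "\<dots> = ennreal (I_k (card C) R (1 / \<sigma>\<^sup>2))"
    by (rule normal_cylinder_Basis[OF C(1) \<open>C \<noteq> {}\<close> \<sigma> R])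
  finally show ?thesis
    using bij_betw_same_card[OF C(2)] by simp
qed

section \<open>Correct decisions under a given noise vector\<close>

lemma mem_lattice_of: "(\<And>i. z $ i \<in> \<int>) \<Longrightarrow> M *v z \<in> lattice_of M"
  unfolding lattice_of_def by blast

lemma d_min_le:
  assumes "invertible M" "\<And>i. z $ i \<in> \<int>" "z \<noteq> 0"
  shows "d_min M \<le> norm (M *v z)"
  unfolding d_min_def
proof (rule cInf_lower)
  have "M *v z \<in> lattice_of M" "M *v 0 \<in> lattice_of M"
    using assms(2) by (intro mem_lattice_of; simp)+
  moreover have "M *v z \<noteq> M *v 0"
    using assms(1,3) by (metis inj_matrix_vector_mult injD)
  moreover have "norm (M *v z) = dist (M *v z) (M *v 0)" by (simp add: dist_norm)
  ultimately show "norm (M *v z) \<in> {dist x y |x y. x \<in> lattice_of M \<and> y \<in> lattice_of M \<and> x \<noteq> y}"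
    by blast
qed (auto intro!: bdd_belowI[of _ 0])

text \<open>An injective linear map stretches every vector by at least some factor
  \<open>B > 0\<close>, and a nonzero integer vector has norm at least 1; hence all distances are at
  least \<open>B\<close>.\<close>

lemma d_min_pos:
  fixes M :: "real^'n^'n"
  assumes M: "invertible M"
  shows "0 < d_min M"
proof -
  obtain B where B: "B > 0" "\<And>x. B * norm x \<le> norm (M *v x)"
    using linear_inj_bounded_below_pos[OF matrix_vector_mul_linear inj_matrix_vector_mult[OF M]]
    by (auto simp: mult.commute)
  have "B \<le> d_min M"
    unfolding d_min_def
  proof (rule cInf_greatest)
    \<comment> \<open>The lower bound passes to \<open>Inf\<close> only for a nonempty set. The
      origin and one column of \<open>M\<close> are distinct lattice points;
      \<open>undefined\<close> is an arbitrary index.\<close>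
    have "M *v axis undefined 1 \<in> lattice_of M" "M *v 0 \<in> lattice_of M"
      by (intro mem_lattice_of; simp add: axis_def)+
    moreover have "M *v axis undefined 1 \<noteq> M *v 0"
      using inj_matrix_vector_mult[OF M] by (metis axis_eq_0_iff injD zero_neq_one)
    ultimately show "{dist x y |x y. x \<in> lattice_of M \<and> y \<in> lattice_of M \<and> x \<noteq> y} \<noteq> {}"
      by blast
  next
    fix d assume "d \<in> {dist x y |x y. x \<in> lattice_of M \<and> y \<in> lattice_of M \<and> x \<noteq> y}"
    then obtain z z' where z: "\<And>i. z $ i \<in> \<int>" "\<And>i. z' $ i \<in> \<int>" "M *v z \<noteq> M *v z'"
      and d: "d = dist (M *v z) (M *v z')"
      unfolding lattice_of_def by blast
    from z(3) have "z \<noteq> z'" by auto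
    then obtain i where i: "(z - z') $ i \<noteq> 0" by (auto simp: vec_eq_iff)
    have "(z - z') $ i \<in> \<int>" using z by simp
    then have "1 \<le> \<bar>(z - z') $ i\<bar>" using i by (rule Ints_nonzero_abs_ge1)
    also have "\<dots> \<le> norm (z - z')" by (rule component_le_norm_cart)
    finally have "B \<le> B * norm (z - z')" using B(1) by simp
    also have "\<dots> \<le> d"
      using B(2)[of "z - z'"] by (simp add: d dist_norm matrix_vector_mult_diff_distrib)
    finally show "B \<le> d" .
  qed
  with B(1) show ?thesis by simp
qed

section \<open>Spans of columns and orthogonal projection onto them\<close>

definition coord_space :: "real^'n^'n \<Rightarrow> 'n set \<Rightarrow> (real^'n) set" where
  "coord_space M S = (*v) M ` {a. \<forall>i. i \<notin> S \<longrightarrow> a $ i = 0}"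

lemma subspace_coord_space: "subspace (coord_space M S)"
  unfolding coord_space_def
  by (intro linear_subspace_image matrix_vector_mul_linear) (simp add: subspace_def)

lemma dim_coord_space:
  fixes M :: "real^'n^'n"
  assumes "invertible M"
  shows "dim (coord_space M S) = card S"
proof -
  have "dim (coord_space M S) = dim {a::real^'n. \<forall>i. i \<notin> S \<longrightarrow> a $ i = 0}"
    unfolding coord_space_def
    by (intro dim_image_eq matrix_vector_mul_linear inj_on_subset[OF inj_matrix_vector_mult[OF assms]]) auto
  then show ?thesis
    using dim_substandard_cart[of S, where ?'a = real] by (simp add: dim_vec_eq)
qed

lemma column_mem_coord_space:
  assumes "invertible M"
  shows "column i M \<in> coord_space M S \<longleftrightarrow> i \<in> S"
proof
  assume "column i M \<in> coord_space M S"
  then obtain a where a: "M *v axis i 1 = M *v a" "\<forall>i. i \<notin> S \<longrightarrow> a $ i = 0"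
    by (auto simp: coord_space_def matrix_vector_mult_basis)
  then have "a = axis i 1" using inj_matrix_vector_mult[OF assms] by (metis injD)
  then show "i \<in> S" using a(2) by (metis axis_nth zero_neq_one)
next
  assume "i \<in> S"
  then show "column i M \<in> coord_space M S"
    by (auto simp: coord_space_def matrix_vector_mult_basis[symmetric] axis_def)
qed

lemma inner_matrix_vector_mult:
  fixes v :: "real^'m"
  shows "v \<bullet> (M *v z) = (\<Sum>i\<in>UNIV. z $ i * (v \<bullet> column i M))"
  by (simp add: matrix_mult_sum inner_sum_right scalar_mult_eq_scaleR)

text \<open>One orthonormal basis is fixed for each \<open>S\<close>. It defines the projection and
  is also the family to which \<open>noise_cylinder\<close> is applied, so that the squared norm of
  the projected noise is the sum occurring there.\<close>

definition coord_basis :: "real^'n^'n \<Rightarrow> 'n set \<Rightarrow> (real^'n) set" where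
  "coord_basis M S = (SOME B. pairwise orthogonal B \<and> (\<forall>x\<in>B. norm x = 1) \<and> independent B \<and>
     card B = dim (coord_space M S) \<and> span B = coord_space M S)"

lemma coord_basis:
  shows orthogonal_coord_basis: "pairwise orthogonal (coord_basis M S)"
    and norm_coord_basis: "x \<in> coord_basis M S \<Longrightarrow> norm x = 1"
    and independent_coord_basis: "independent (coord_basis M S)"
    and card_coord_basis_dim: "card (coord_basis M S) = dim (coord_space M S)"
    and span_coord_basis: "span (coord_basis M S) = coord_space M S"
proof -
  have "\<exists>B. pairwise orthogonal B \<and> (\<forall>x\<in>B. norm x = 1) \<and> independent B \<and>
     card B = dim (coord_space M S) \<and> span B = coord_space M S"
    using orthonormal_basis_subspace[OF subspace_coord_space[of M S]] by metis
  from someI_ex[OF this]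
  show "pairwise orthogonal (coord_basis M S)"
    "x \<in> coord_basis M S \<Longrightarrow> norm x = 1" "independent (coord_basis M S)"
    "card (coord_basis M S) = dim (coord_space M S)" "span (coord_basis M S) = coord_space M S"
    unfolding coord_basis_def by blast+
qed

lemma card_coord_basis: "invertible M \<Longrightarrow> card (coord_basis M S) = card S"
  by (simp add: card_coord_basis_dim dim_coord_space)

definition coord_proj :: "real^'n^'n \<Rightarrow> 'n set \<Rightarrow> real^'n \<Rightarrow> real^'n" where
  "coord_proj M S w = (\<Sum>e\<in>coord_basis M S. (w \<bullet> e) *\<^sub>R e)"

lemma inner_coord_proj: "coord_proj M S w \<bullet> v = (\<Sum>e\<in>coord_basis M S. (w \<bullet> e) * (v \<bullet> e))"
  unfolding coord_proj_def inner_sum_left inner_scaleR_left by (simp add: inner_commute)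

lemma inner_coord_proj_swap: "coord_proj M S v \<bullet> w = v \<bullet> coord_proj M S w"
  by (simp add: inner_coord_proj inner_commute[of v] mult.commute)

lemma coord_proj_inner_basis:
  assumes "e \<in> coord_basis M S"
  shows "coord_proj M S w \<bullet> e = w \<bullet> e"
proof -
  have "e \<bullet> e' = (if e = e' then 1 else 0)" if "e' \<in> coord_basis M S" for e'
    using orthogonal_coord_basis[of M S] norm_coord_basis[of _ M S] that assms
    by (auto simp: pairwise_def orthogonal_def norm_eq_1)
  then have "coord_proj M S w \<bullet> e = (\<Sum>e'\<in>coord_basis M S. if e = e' then w \<bullet> e' else 0)"
    unfolding inner_coord_proj by (intro sum.cong refl) simp
  then show ?thesis
    using assms independent_imp_finite[OF independent_coord_basis[of M S]] by simp
qed

lemma norm_coord_proj: "(norm (coord_proj M S w))\<^sup>2 = (\<Sum>e\<in>coord_basis M S. (w \<bullet> e)\<^sup>2)"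
  unfolding power2_norm_eq_inner inner_coord_proj[of M S w "coord_proj M S w"]
  by (intro sum.cong refl) (simp add: coord_proj_inner_basis power2_eq_square)

lemma coord_proj_mem: "coord_proj M S w \<in> coord_space M S"
  unfolding coord_proj_def span_coord_basis[symmetric] by (intro span_sum span_scale span_base)

lemma inner_diff_coord_proj:
  assumes "v \<in> coord_space M S"
  shows "(w - coord_proj M S w) \<bullet> v = 0"
proof -
  have "v \<in> span (coord_basis M S)" using assms by (simp add: span_coord_basis)
  moreover have "orthogonal (w - coord_proj M S w) e" if "e \<in> coord_basis M S" for e
    using that by (simp add: orthogonal_def inner_diff_left coord_proj_inner_basis)
  ultimately show ?thesis
    using orthogonal_to_span unfolding orthogonal_def by blast
qed

section \<open>Transmitted points selected by a decomposition of the noise\<close>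

text \<open>Here \<open>p + M *v a\<close> is the orthogonal decomposition of the noise with respect to
  \<^term>\<open>coord_space M S\<close>. Off \<open>S\<close>, the sign of the inner product with \<open>p\<close> forces an
  extreme coordinate; on \<open>S\<close>, the sign of the coefficient excludes only one extreme.\<close>
definition choices :: "nat \<Rightarrow> real^'n^'n \<Rightarrow> 'n set \<Rightarrow> real^'n \<Rightarrow> real^'n \<Rightarrow> 'n \<Rightarrow> nat set" where
  "choices K M S p a i =
    (if i \<in> S then (if 0 \<le> a $ i then {..<K - 1} else {1..<K})
     else (if p \<bullet> column i M < 0 then {0} else {K - 1}))"

text \<open>This is the source of the weight in the bound: on \<open>S\<close> either sign leaves
  \<open>K - 1\<close> values, and elsewhere a single value is left.\<close>

lemma card_Pi_choices:
  "card (Pi UNIV (choices K M S p a)) = (K - 1) ^ card S"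
proof -
  have "card (Pi UNIV (choices K M S p a)) = (\<Prod>i\<in>UNIV. card (choices K M S p a i))"
    by (simp add: card_PiE flip: PiE_UNIV_domain)
  also have "\<dots> = (\<Prod>i\<in>UNIV. if i \<in> S then K - 1 else 1)"
    by (intro prod.cong) (auto simp: choices_def)
  also have "\<dots> = (K - 1) ^ card S"
    by (simp add: prod.If_cases)
  finally show ?thesis .
qed

lemma choices_less:
  assumes "K \<ge> 2" "u \<in> Pi UNIV (choices K M S p a)"
  shows "u i < K"
  using assms by (auto simp: Pi_iff choices_def split: if_splits dest!: spec[of _ i])

text \<open>Each summand is nonpositive, and only \<open>i\<close> in \<open>S\<close> but not in
  \<open>S'\<close> can contribute. There \<open>0 \<le> a $ i\<close> excludes
  \<open>u i = K - 1\<close>, so the rule for \<open>S'\<close> must have picked 0 because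
  \<open>p' \<bullet> column i M < 0\<close>. A negative \<open>a $ i\<close> excludes
  \<open>u i = 0\<close>, so that inner product is nonnegative.\<close>

lemma choices_inner_nonpos:
  assumes K: "K \<ge> 2"
    and u: "u \<in> Pi UNIV (choices K M S p a)" "u \<in> Pi UNIV (choices K M S' p' a')"
    and a: "\<forall>i. i \<notin> S \<longrightarrow> a $ i = 0" and p': "\<forall>i\<in>S'. p' \<bullet> column i M = 0"
  shows "p' \<bullet> (M *v a) \<le> 0"
  unfolding inner_matrix_vector_mult
proof (rule sum_nonpos)
  fix i
  have "u i \<in> choices K M S p a i" "u i \<in> choices K M S' p' a' i" using u by auto
  then show "a $ i * (p' \<bullet> column i M) \<le> 0"
    using a p' K by (cases "i \<in> S"; cases "i \<in> S'")
      (auto simp: choices_def mult_le_0_iff split: if_splits)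
qed

text \<open>The vector \<open>p\<close> is the metric projection of \<open>w\<close> onto the polar of the cone of lattice
  directions available at \<open>u\<close>. This projection is unique, and \<open>S\<close> is the set of columns
  of \<open>M\<close> to which it is orthogonal.\<close>
lemma choices_disjoint:
  assumes K: "K \<ge> 2"
    and u: "u \<in> Pi UNIV (choices K M S p a)" "u \<in> Pi UNIV (choices K M S' p' a')"
    and a: "\<forall>i. i \<notin> S \<longrightarrow> a $ i = 0" and a': "\<forall>i. i \<notin> S' \<longrightarrow> a' $ i = 0"
    and p: "\<forall>i. p \<bullet> column i M = 0 \<longleftrightarrow> i \<in> S" and p': "\<forall>i. p' \<bullet> column i M = 0 \<longleftrightarrow> i \<in> S'"
    and w: "w = p + M *v a" "w = p' + M *v a'"
  shows "S = S'"
proof -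
  have "p \<bullet> (M *v a) = 0" "p' \<bullet> (M *v a') = 0"
    unfolding inner_matrix_vector_mult using a p a' p' by (auto intro!: sum.neutral)
  moreover have "p' \<bullet> (M *v a) \<le> 0" "p \<bullet> (M *v a') \<le> 0"
    using choices_inner_nonpos[OF K u a] choices_inner_nonpos[OF K u(2,1) a'] p p' by auto
  moreover have "p - p' = M *v a' - M *v a" using w by (simp add: algebra_simps)
  \<comment> \<open>Replacing the second factor by \<open>M *v a' - M *v a\<close> expands the
    square to \<open>p \<bullet> (M *v a') + p' \<bullet> (M *v a)\<close>, the other two terms
    being 0.\<close>
  ultimately have "(p - p') \<bullet> (p - p') \<le> 0"
    by (metis (no_types) add_nonpos_nonpos inner_diff_left inner_diff_right diff_0 diff_0_right
        minus_diff_eq diff_conv_add_uminus add.inverse_inverse add.commute)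
  then have "p = p'" by (metis eq_iff_diff_eq_0 inner_eq_zero_iff inner_ge_zero order_antisym)
  with p p' show ?thesis by blast
qed

text \<open>The claim amounts to
  \<open>2 * (w \<bullet> (M *v z)) < (M *v z) \<bullet> (M *v z)\<close>. The part \<open>p\<close>
  contributes a nonpositive amount, and by Cauchy-Schwarz the part \<open>M *v a\<close> contributes
  too little, since its norm is below half of \<open>norm (M *v z)\<close>.\<close>

lemma norm_less_shifted:
  assumes M: "invertible M" and K: "K \<ge> 2"
    and u: "u \<in> Pi UNIV (choices K M S p a)"
    and p: "\<forall>i\<in>S. p \<bullet> column i M = 0"
    and w: "w = p + M *v a" and near: "norm (M *v a) < d_min M / 2"
    and u': "\<And>i. u' i < K" "u' \<noteq> u"
  defines "z \<equiv> (\<chi> i. real (u' i) - real (u i))"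
  shows "norm w < norm (w - M *v z)"
proof -
  obtain j where "u' j \<noteq> u j" using u'(2) by blast
  then have "z $ j \<noteq> 0" by (simp add: z_def)
  then have "z \<noteq> 0" by auto
  then have dz: "d_min M \<le> norm (M *v z)"
    by (intro d_min_le[OF M]) (simp_all add: z_def)
  have "p \<bullet> (M *v z) \<le> 0"
    unfolding inner_matrix_vector_mult
  proof (rule sum_nonpos)
    fix i
    have "u i \<in> choices K M S p a i" using u by auto
    \<comment> \<open>Outside \<open>S\<close>, a negative inner product means
      \<open>u i = 0\<close> and hence \<open>z $ i \<ge> 0\<close>; otherwise
      \<open>u i = K - 1\<close> and \<open>z $ i \<le> 0\<close>.\<close>
    then show "z $ i * (p \<bullet> column i M) \<le> 0"
      using p u'(1)[of i] by (auto simp: choices_def z_def mult_le_0_iff split: if_splits)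
  qed
  moreover have "(M *v a) \<bullet> (M *v z) \<le> norm (M *v a) * norm (M *v z)"
    by (rule norm_cauchy_schwarz)
  moreover have "norm (M *v a) * norm (M *v z) < norm (M *v z) / 2 * norm (M *v z)"
    using near dz d_min_pos[OF M] by (intro mult_strict_right_mono) linarith+
  ultimately have "2 * (w \<bullet> (M *v z)) < (M *v z) \<bullet> (M *v z)"
    unfolding w by (simp add: inner_add_left power2_norm_eq_inner[symmetric] power2_eq_square)
  then show ?thesis
    by (simp add: norm_lt inner_diff_left inner_diff_right inner_commute)
qed

section \<open>Generic noise, likelihoods and decision regions\<close>

lemma AE_noise_inner_neq_0:
  fixes c :: "real^'n"
  assumes "c \<noteq> 0"
  shows "AE w in noise \<sigma>. w \<bullet> c \<noteq> 0"
proof -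
  have "{w. c \<bullet> w = 0} \<in> null_sets lebesgue"
    using negligible_hyperplane[of c 0] assms by (simp add: negligible_iff_null_sets)
  \<comment> \<open>\<open>negligible\<close> refers to the completed measure; the hyperplane is
    Borel, so nullity descends to \<open>lborel\<close>.\<close>
  moreover have "{w. c \<bullet> w = 0} \<in> sets lborel" by measurable
  ultimately have "{w. c \<bullet> w = 0} \<in> null_sets lborel"
    using null_sets_completion_iff by blast
  then have "AE w in lborel. w \<bullet> c \<noteq> 0"
    by (rule AE_I') (auto simp: inner_commute)
  then show ?thesis
    unfolding noise_def by (subst AE_density) auto
qed

lemma noise_density_less_iff:
  fixes v w :: "real^'n"
  assumes "\<sigma> > 0"
  shows "noise_density \<sigma> v < noise_density \<sigma> w \<longleftrightarrow> norm w < norm v"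
proof -
  have "0 < (1 / sqrt (2 * pi * \<sigma>\<^sup>2)) ^ CARD('n)"
    using assms by simp
  then have "noise_density \<sigma> v < noise_density \<sigma> w \<longleftrightarrow> (norm w)\<^sup>2 < (norm v)\<^sup>2"
    using assms by (simp add: noise_density_norm divide_less_cancel)
  then show ?thesis by (simp add: power_mono_iff linorder_not_le[symmetric])
qed

text \<open>Messages are functions into \<open>nat\<close>, so that the sets built from
  \<open>choices\<close> are finite products that can be counted; \<open>inj_signal\<close>
  transports the count to constellation points.\<close>

definition signal :: "real^'n^'n \<Rightarrow> ('n \<Rightarrow> nat) \<Rightarrow> real^'n" where
  "signal M u = M *v (\<chi> i. real (u i))"

lemma constellation_eq_signal: "constellation M K = signal M ` (Pi UNIV (\<lambda>_. {..<K}))"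
proof (intro equalityI subsetI)
  fix x assume "x \<in> constellation M K"
  then obtain u where u: "x = M *v u" "\<forall>i. u $ i \<in> real ` {..<K}"
    by (auto simp: constellation_def)
  then have "\<forall>i. \<exists>n. n < K \<and> u $ i = real n" by blast
  then obtain v where v: "\<forall>i. v i < K \<and> u $ i = real (v i)" by metis
  then have "u = (\<chi> i. real (v i))" by (simp add: vec_eq_iff)
  then have "x = signal M v" by (simp add: u(1) signal_def)
  with v show "x \<in> signal M ` (Pi UNIV (\<lambda>_. {..<K}))" by auto
next
  fix x assume "x \<in> signal M ` (Pi UNIV (\<lambda>_. {..<K}))"
  then obtain v where v: "x = signal M v" "\<forall>i. v i < K" by auto
  then show "x \<in> constellation M K"
    unfolding constellation_def signal_def by (intro CollectI exI[of _ "\<chi> i. real (v i)"]) auto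
qed

lemma inj_signal:
  assumes "invertible M"
  shows "inj (signal M)"
proof (rule injI)
  fix u v assume "signal M u = signal M v"
  then have "(\<chi> i. real (u i)) = (\<chi> i. real (v i))"
    using inj_matrix_vector_mult[OF assms] unfolding signal_def by (metis injD)
  then show "u = v" by (auto simp: vec_eq_iff)
qed

lemma sum_Pow_card:
  fixes f :: "nat \<Rightarrow> real"
  assumes "finite A"
  shows "(\<Sum>S\<in>Pow A. f (card S)) = (\<Sum>k=0..card A. real (card A choose k) * f k)"
proof -
  have "(\<Sum>S\<in>Pow A. f (card S)) = (\<Sum>k=0..card A. \<Sum>S\<in>{S \<in> Pow A. card S = k}. f (card S))"
    using assms by (intro sum.group[symmetric]) (auto intro: card_mono)
  also have "\<dots> = (\<Sum>k=0..card A. real (card A choose k) * f k)"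
    using n_subsets[OF assms] by (intro sum.cong refl) (simp add: Pow_def)
  finally show ?thesis .
qed

definition correct_region :: "real^'n^'n \<Rightarrow> nat \<Rightarrow> real \<Rightarrow> real^'n \<Rightarrow> (real^'n) set" where
  "correct_region M K \<sigma> x =
    {w. \<forall>p\<in>constellation M K. p \<noteq> x \<longrightarrow> likelihood \<sigma> (x + w) p < likelihood \<sigma> (x + w) x}"

lemma finite_Pi_lessThan: "finite (Pi UNIV (\<lambda>_::'n::finite. {..<K::nat}))"
  using finite_PiE[of UNIV "\<lambda>_::'n. {..<K}"] by (simp add: PiE_UNIV_domain)

lemma finite_constellation: "finite (constellation M K)"
  by (simp add: constellation_eq_signal finite_Pi_lessThan)

lemma sets_correct_region [measurable]: "correct_region M K \<sigma> x \<in> sets borel"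
proof -
  have "Measurable.pred borel (\<lambda>w. \<forall>p\<in>constellation M K. p \<noteq> x \<longrightarrow>
      noise_density \<sigma> (x + w - p) < noise_density \<sigma> (x + w - x))"
    by (intro pred_intros_finite finite_constellation) measurable
  then show ?thesis
    by (simp add: correct_region_def likelihood_def pred_def)
qed

lemma choices_correct_region:
  assumes M: "invertible M" and K: "K \<ge> 2" and \<sigma>: "\<sigma> > 0"
    and u: "u \<in> Pi UNIV (choices K M S p a)"
    and p: "\<forall>i\<in>S. p \<bullet> column i M = 0"
    and w: "w = p + M *v a" and near: "norm (M *v a) < d_min M / 2"
  shows "w \<in> correct_region M K \<sigma> (signal M u)"
proof -
  have "likelihood \<sigma> (signal M u + w) (signal M u') < likelihood \<sigma> (signal M u + w) (signal M u)"
    if u': "u' \<in> Pi UNIV (\<lambda>_. {..<K})" "signal M u' \<noteq> signal M u" for u'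
  proof -
    have "norm w < norm (w - M *v (\<chi> i. real (u' i) - real (u i)))"
      using u' by (intro norm_less_shifted[OF M K u p w near]) auto
    also have "(\<chi> i. real (u' i) - real (u i)) = (\<chi> i. real (u' i)) - (\<chi> i. real (u i))"
      by (simp add: vec_eq_iff)
    also have "w - M *v \<dots> = signal M u + w - signal M u'"
      by (simp add: signal_def matrix_vector_mult_diff_distrib)
    finally show ?thesis using \<sigma> by (simp add: likelihood_def noise_density_less_iff)
  qed
  then show ?thesis by (auto simp: correct_region_def constellation_eq_signal)
qed

section \<open>Averaging the count over the noise\<close>

lemma sum_correct_prob_ge:
  fixes M :: "real^'n^'n"
  assumes M: "invertible M" and K: "K \<ge> 2" and \<sigma>: "\<sigma> > 0"
  shows "(\<Sum>S\<in>UNIV. real (K - 1) ^ card (S :: 'n set) * I_k (card S) (d_min M / 2) (1 / \<sigma>\<^sup>2))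
    \<le> (\<Sum>x\<in>constellation M K. correct_prob M K \<sigma> x)"
proof -
  interpret prob_space "noise \<sigma> :: (real^'n) measure" by (rule prob_space_noise[OF \<sigma>])
  define R where "R = d_min M / 2"
  have R: "R > 0" using d_min_pos[OF M] by (simp add: R_def)
  define U where "U = Pi UNIV (\<lambda>_::'n. {..<K})"
  have "finite U" unfolding U_def by (rule finite_Pi_lessThan)
  define V where "V u = correct_region M K \<sigma> (signal M u)" for u
  \<comment> \<open>The coefficients of the projected noise are picked separately for each
    \<open>w\<close>; they serve the counting argument at a fixed \<open>w\<close>, while only
    cylinders and decision regions are integrated.\<close>
  define a where "a S w = (SOME a. coord_proj M S w = M *v a \<and> (\<forall>i. i \<notin> S \<longrightarrow> a $ i = 0))" for S w
  have a: "coord_proj M S w = M *v a S w" "\<forall>i. i \<notin> S \<longrightarrow> a S w $ i = 0" for S w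
  proof -
    have "\<exists>a. coord_proj M S w = M *v a \<and> (\<forall>i. i \<notin> S \<longrightarrow> a $ i = 0)"
      using coord_proj_mem[of M S w] by (auto simp: coord_space_def)
    from someI_ex[OF this] show "coord_proj M S w = M *v a S w" "\<forall>i. i \<notin> S \<longrightarrow> a S w $ i = 0"
      by (auto simp: a_def)
  qed
  define p where "p S w = w - coord_proj M S w" for S w
  have w: "w = p S w + M *v a S w" for S w by (simp add: p_def a(1)[symmetric])
  have p0: "\<forall>i\<in>S. p S w \<bullet> column i M = 0" for S w
    unfolding p_def by (intro ballI inner_diff_coord_proj) (simp add: column_mem_coord_space[OF M])
  define cyl where "cyl S = {w. (\<Sum>e\<in>coord_basis M S. (w \<bullet> e)\<^sup>2) < R\<^sup>2}" for S
  have near: "norm (M *v a S w) < d_min M / 2" if "w \<in> cyl S" for S w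
  proof -
    have "(norm (M *v a S w))\<^sup>2 < R\<^sup>2"
      using that by (simp add: cyl_def a(1)[symmetric] norm_coord_proj)
    from power_less_imp_less_base[OF this] R show ?thesis by (simp add: R_def)
  qed
  have [measurable]: "V u \<in> sets borel" "cyl S \<in> sets borel" for u S
    unfolding V_def cyl_def by measurable
  have [simp]: "integrable (noise \<sigma>) (indicat_real A)" if "A \<in> sets borel" for A :: "(real^'n) set"
    using that by (intro integrable_real_indicator) (auto simp: less_top[symmetric])
  have generic: "AE w in noise \<sigma>. \<forall>S. \<forall>i. i \<notin> S \<longrightarrow> p S w \<bullet> column i M \<noteq> 0"
  proof -
    \<comment> \<open>The projection is symmetric, so this is the inner product of \<open>w\<close>
      with the residual of \<open>column i M\<close>, which is nonzero because the column lies
      outside \<open>coord_space M S\<close>. Only finitely many hyperplanes are discarded.\<close>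
    have "AE w in noise \<sigma>. p S w \<bullet> column i M \<noteq> 0" if "i \<notin> S" for S i
    proof -
      have "column i M - coord_proj M S (column i M) \<noteq> 0"
        using that coord_proj_mem[of M S "column i M"] column_mem_coord_space[OF M] by auto
      moreover have "p S w \<bullet> column i M = w \<bullet> (column i M - coord_proj M S (column i M))" for w
        by (simp add: p_def inner_diff_left inner_diff_right inner_coord_proj_swap)
      ultimately show ?thesis
        using AE_noise_inner_neq_0[of "column i M - coord_proj M S (column i M)" \<sigma>] by simp
    qed
    then show ?thesis by (simp add: AE_all_countable AE_finite_all countable_finite)
  qed
  have count: "(\<Sum>S\<in>UNIV. real (K - 1) ^ card S * indicator (cyl S) w) \<le> (\<Sum>u\<in>U. indicator (V u) w)"
    if gen: "\<forall>S. \<forall>i. i \<notin> S \<longrightarrow> p S w \<bullet> column i M \<noteq> 0" for w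
  proof -
    define F where "F S = Pi UNIV (choices K M S (p S w) (a S w))" for S
    define T where "T = {S. w \<in> cyl S}"
    have FU: "F S \<subseteq> U" for S
      using choices_less[OF K] by (auto simp: F_def U_def)
    have FV: "F S \<subseteq> {u. w \<in> V u}" if "S \<in> T" for S
      using choices_correct_region[OF M K \<sigma> _ p0 w near] that by (auto simp: F_def V_def T_def)
    have disj: "F S \<inter> F S' = {}" if "S \<noteq> S'" for S S'
    proof -
      have pS: "\<forall>i. p S w \<bullet> column i M = 0 \<longleftrightarrow> i \<in> S" for S using gen p0 by blast
      show ?thesis
        using choices_disjoint[OF K _ _ a(2) a(2) pS pS w w] that unfolding F_def by blast
    qed
    have "(\<Sum>S\<in>UNIV. real (K - 1) ^ card S * indicator (cyl S) w) = (\<Sum>S\<in>T. real (K - 1) ^ card S)"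
      by (simp add: T_def indicator_def if_distrib[of "(*) _"] sum.If_cases cong: if_cong)
    also have "\<dots> = real (\<Sum>S\<in>T. card (F S))"
      by (simp add: F_def card_Pi_choices)
    also have "(\<Sum>S\<in>T. card (F S)) = card (\<Union>S\<in>T. F S)"
      using FU \<open>finite U\<close> disj by (intro card_UN_disjoint[symmetric]) (auto intro: finite_subset)
    also have "\<dots> \<le> card {u \<in> U. w \<in> V u}"
      using FU FV \<open>finite U\<close> by (intro card_mono) auto
    also have "real (card {u \<in> U. w \<in> V u}) = (\<Sum>u\<in>U. indicator (V u) w)"
      using \<open>finite U\<close> by (simp add: indicator_def sum.If_cases Int_def)
    finally show ?thesis by simp
  qed
  \<comment> \<open>The cylinder formula gives equality after \<open>ennreal\<close>, which sends
    negative reals to 0. As a probability is nonnegative, the inequality follows whatever the sign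
    of \<open>I_k\<close>, and it has the direction required.\<close>
  have I_le: "I_k (card S) R (1 / \<sigma>\<^sup>2) \<le> prob (cyl S)" for S
  proof -
    have "ennreal (prob (cyl S)) = ennreal (I_k (card S) R (1 / \<sigma>\<^sup>2))"
      unfolding cyl_def emeasure_eq_measure[symmetric] card_coord_basis[OF M, of S, symmetric]
      by (rule noise_cylinder[OF orthogonal_coord_basis norm_coord_basis \<sigma> R])
    then show ?thesis
      using ennreal_le_iff[of "prob (cyl S)" "I_k (card S) R (1 / \<sigma>\<^sup>2)"] by simp
  qed
  have "(\<Sum>S\<in>UNIV. real (K - 1) ^ card (S :: 'n set) * I_k (card S) R (1 / \<sigma>\<^sup>2))
     \<le> (\<Sum>S\<in>UNIV. real (K - 1) ^ card S * prob (cyl S))"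
    by (intro sum_mono mult_left_mono I_le) auto
  also have "\<dots> = (\<integral>w. (\<Sum>S\<in>UNIV. real (K - 1) ^ card S * indicator (cyl S) w) \<partial>noise \<sigma>)"
    by (subst Bochner_Integration.integral_sum) auto
  also have "\<dots> \<le> (\<integral>w. (\<Sum>u\<in>U. indicator (V u) w) \<partial>noise \<sigma>)"
  proof (rule integral_mono_AE)
    show "AE w in noise \<sigma>. (\<Sum>S\<in>UNIV. real (K - 1) ^ card S * indicator (cyl S) w) \<le> (\<Sum>u\<in>U. indicat_real (V u) w)"
      using generic by (rule eventually_mono) (rule count)
  qed (intro Bochner_Integration.integrable_sum integrable_mult_right; simp)+
  also have "\<dots> = (\<Sum>u\<in>U. prob (V u))"
    by (subst Bochner_Integration.integral_sum) auto
  also have "\<dots> = (\<Sum>x\<in>constellation M K. correct_prob M K \<sigma> x)"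
    unfolding constellation_eq_signal U_def[symmetric]
    by (subst sum.reindex[OF inj_on_subset[OF inj_signal[OF M]]])
      (auto simp: V_def correct_prob_def correct_region_def)
  finally show ?thesis by (simp add: R_def)
qed

theorem theorem3:
  fixes M :: "real^'n^'n" and K :: nat and \<sigma> :: real
  assumes "K \<ge> 2" and "\<bar>det M\<bar> = 1" and "\<sigma> > 0"
  shows "SEP M K \<sigma> \<le> 1 - (1 / real K ^ CARD('n)) *
     (\<Sum>k=0..CARD('n). real (K - 1) ^ k * real (CARD('n) choose k) * I_k k (d_min M / 2) (1 / \<sigma>^2))"
proof -
  have M: "invertible M" using assms(2) by (auto simp: invertible_det_nz)
  \<comment> \<open>The \<open>CARD('n) choose k\<close> coordinate sets of size \<open>k\<close>
    share one summand, so the binomial sum is a sum over all coordinate sets.\<close>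
  have "(\<Sum>k=0..CARD('n). real (K - 1) ^ k * real (CARD('n) choose k) * I_k k (d_min M / 2) (1 / \<sigma>^2))
    = (\<Sum>S\<in>UNIV. real (K - 1) ^ card (S :: 'n set) * I_k (card S) (d_min M / 2) (1 / \<sigma>\<^sup>2))"
    using sum_Pow_card[of "UNIV :: 'n set" "\<lambda>k. real (K - 1) ^ k * I_k k (d_min M / 2) (1 / \<sigma>\<^sup>2)"]
    by (simp add: mult_ac)
  also have "\<dots> \<le> (\<Sum>x\<in>constellation M K. correct_prob M K \<sigma> x)"
    by (rule sum_correct_prob_ge[OF M assms(1,3)])
  finally show ?thesis
    unfolding SEP_def by (intro diff_left_mono mult_left_mono) auto
qed

end
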